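(* Let $J$ and $f$ satisfy assumptions (H1) and (H2) stated in the context, and let $u(t,x)$ be a transition front of $u_t=J\ast u-u+f(t,u)$ with the properties (P) listed in the context. For $t\in\mathbb{R}$ let $X_\theta(t)$ be the unique point with $u(t,X_\theta(t))=\theta$. Then, for any $\delta>0$, $$\sup_{|t-s|\le\delta}|X_\theta(t)-X_\theta(s)|<\infty ,$$ where the supremum is over all $t,s\in\mathbb{R}$ with $|t-s|\le\delta$. In particular, $\limsup_{t\to\pm\infty}\left|\frac{X_\theta(t)}{t}\right|<\infty$.
   Context: Notation: $[J\ast u](x)=\int_{\mathbb{R}}J(x-y)u(y)\,dy$ (convolution in the space variable). (H1) $J\not\equiv 0$, $J\in C^1(\mathbb{R})$, $J(x)=J(-x)\ge 0$ for all $x\in\mathbb{R}$, $\int_{\mathbb{R}}J(x)\,dx=1$, $\int_{\mathbb{R}}|J'(x)|\,dx<\infty$, and $\int_{\mathbb{R}}J(x)e^{\lambda x}\,dx<\infty$ for all $\lambda>0$. (H2) $f:\mathbb{R}\times[0,\infty)\to\mathbb{R}$ is continuously differentiable and satisfies: - there are $\theta\in(0,1)$ (the ignition temperature), $f_{\min}\in C^{1,\alpha}([0,1])$ (for some Hölder exponent $\alpha\in(0,1)$) and a Lipschitz continuous $f_{\max}:[0,1]\to\mathbb{R}$ with $f_{\min}(u)=0=f_{\max}(u)$ for $u\in[0,\theta]\cup\{1\}$, $0<f_{\min}(u)\le f_{\max}(u)$ for $u\in(\theta,1)$, $f_{\min}'(1)<0$, such that $f_{\min}(u)\le f(t,u)\le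 f_{\max}(u)$ for $(t,u)\in\mathbb{R}\times[0,1]$; - $f(t,u)<0$ for $(t,u)\in\mathbb{R}\times(1,\infty)$; - $\sup_{(t,u)\in\mathbb{R}\times[0,1]}|f_t(t,u)|<\infty$ and $\sup_{(t,u)\in\mathbb{R}\times[0,\infty)}|f_u(t,u)|<\infty$; - there exists $\tilde\theta\in(\theta,1)$ such that $\frac{f(t,u_1)-f(t,u_2)}{u_1-u_2}\le 0$ for all $u_1,u_2\in[\tilde\theta,1]$, $u_1\ne u_2$, $t\in\mathbb{R}$. Transition front: an entire solution $u(t,x)$ (i.e. a solution defined for all $(t,x)\in\mathbb{R}\times\mathbb{R}$) of the equation is called a transition front if $u(t,-\infty)=1$ and $u(t,\infty)=0$ for every $t\in\mathbb{R}$, and for every $\epsilon\in(0,1)$, $\sup_{t\in\mathbb{R}}\operatorname{diam}\{x\in\mathbb{R}\mid \epsilon\le u(t,x)\le 1-\epsilon\}<\infty$. Properties (P): $u(t,x)$ is strictly decreasing in $x$; $\sup_{x\ne y,\,t\in\mathbb{R}}\left|\frac{u(t,y)-u(t,x)}{y-x}\right|<\infty$; and there exist a continuously differentiable $X:\mathbb{R}\to\mathbb{R}$ and constants $c^*_{\min},c^*_{\max},c_\pm,h_\pm>0$ such that, for all $t\in\mathbb{R}$, $c^*_{\min}\le\dot X(t)\le c^*_{\max}$, $u(t,x+X(t)+h_+)\le e^{-c_+x}$ for $x\ge0$, and $u(t,x+X(t)-h_-)\ge 1-e^{c_-x}$ for $x\le 0$. By monotonicity in $x$, $X_\theta(t)$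 is well defined and continuous in $t$. *)

theory Defs
  imports "HOL-Analysis.Analysis"
begin

text \<open>
  Suprema of nonnegative quantities are called finite by means of \<^const>\<open>bdd_above\<close>,
  and finiteness of integrals by Lebesgue integrability (\<^const>\<open>integrable\<close>); the
  integrands concerned are continuous and nonnegative.
\<close>

definition convol :: "(real \<Rightarrow> real) \<Rightarrow> (real \<Rightarrow> real) \<Rightarrow> real \<Rightarrow> real" where
  "convol J v x = (LINT y|lborel. J (x - y) * v y)"

definition dispersal_kernel :: "(real \<Rightarrow> real) \<Rightarrow> bool" where
  "dispersal_kernel J \<longleftrightarrow>
     (\<exists>x. J x \<noteq> 0) \<and>
     J C1_differentiable_on UNIV \<and>
     (\<forall>x. J x = J (- x) \<and> J x \<ge> 0) \<and>
     integrable lborel J \<and> (LINT x|lborel. J x) = 1 \<and>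
     integrable lborel (\<lambda>x. \<bar>deriv J x\<bar>) \<and>
     (\<forall>\<mu>>0. integrable lborel (\<lambda>x. J x * exp (\<mu> * x)))"

text \<open>
  The nonlinearity has domain \<open>\<real> \<times> [0,\<infinity>)\<close>. It is represented by a total function whose
  values at negative \<open>u\<close> are irrelevant: derivatives are taken within the domain, so the
  derivative in \<open>u\<close> is one-sided at \<open>u = 0\<close>.
\<close>

definition partial_t :: "(real \<Rightarrow> real \<Rightarrow> real) \<Rightarrow> real \<Rightarrow> real \<Rightarrow> real" where
  "partial_t f t u = deriv (\<lambda>s. f s u) t"

definition partial_u :: "(real \<Rightarrow> real \<Rightarrow> real) \<Rightarrow> real \<Rightarrow> real \<Rightarrow> real" where
  "partial_u f t u = vector_derivative (f t) (at u within {0..})"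

definition C1_halfplane :: "(real \<Rightarrow> real \<Rightarrow> real) \<Rightarrow> bool" where
  "C1_halfplane f \<longleftrightarrow>
     (\<forall>t. \<forall>u\<ge>0. ((\<lambda>(s, v). f s v) has_derivative
          (\<lambda>(h, k). partial_t f t u * h + partial_u f t u * k)) (at (t, u) within UNIV \<times> {0..})) \<and>
     continuous_on (UNIV \<times> {0..}) (\<lambda>(t, u). partial_t f t u) \<and>
     continuous_on (UNIV \<times> {0..}) (\<lambda>(t, u). partial_u f t u)"

definition C1_Holder_on :: "real \<Rightarrow> real set \<Rightarrow> (real \<Rightarrow> real) \<Rightarrow> bool" where
  "C1_Holder_on \<alpha> S g \<longleftrightarrow>
     (\<exists>g'. (\<forall>x\<in>S. (g has_real_derivative g' x) (at x within S)) \<and>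
           (\<exists>C. \<forall>x\<in>S. \<forall>y\<in>S. \<bar>g' x - g' y\<bar> \<le> C * \<bar>x - y\<bar> powr \<alpha>))"

text \<open>
  The ignition temperature \<open>\<theta>\<close> is a parameter because the conclusion refers to it; it is
  determined by \<open>f\<close>, since \<open>f t\<close> vanishes on \<open>[0,\<theta>]\<close> and is positive on \<open>(\<theta>,1)\<close>.
\<close>

definition ignition_nonlinearity :: "(real \<Rightarrow> real \<Rightarrow> real) \<Rightarrow> real \<Rightarrow> bool" where
  "ignition_nonlinearity f \<theta> \<longleftrightarrow>
     C1_halfplane f \<and>
     0 < \<theta> \<and> \<theta> < 1 \<and>
     (\<exists>fmin fmax \<alpha>.
        0 < \<alpha> \<and> \<alpha> < 1 \<and> C1_Holder_on \<alpha> {0..1} fmin \<and>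
        (\<exists>L. L-lipschitz_on {0..1} fmax) \<and>
        (\<forall>u \<in> {0..\<theta>} \<union> {1}. fmin u = 0 \<and> fmax u = 0) \<and>
        (\<forall>u \<in> {\<theta><..<1}. 0 < fmin u \<and> fmin u \<le> fmax u) \<and>
        vector_derivative fmin (at 1 within {0..1}) < 0 \<and>
        (\<forall>t. \<forall>u\<in>{0..1}. fmin u \<le> f t u \<and> f t u \<le> fmax u)) \<and>
     (\<forall>t. \<forall>u>1. f t u < 0) \<and>
     bdd_above {\<bar>partial_t f t u\<bar> | t u. 0 \<le> u \<and> u \<le> 1} \<and>
     bdd_above {\<bar>partial_u f t u\<bar> | t u. 0 \<le> u} \<and>
     (\<exists>\<theta>'. \<theta> < \<theta>' \<and> \<theta>' < 1 \<and>
        (\<forall>t. \<forall>u1\<in>{\<theta>'..1}. \<forall>u2\<in>{\<theta>'..1}. u1 \<noteq> u2 \<longrightarrow>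
           (f t u1 - f t u2) / (u1 - u2) \<le> 0))"

text \<open>
  Nonnegativity keeps \<open>u\<close> inside the domain of \<open>f\<close>, and integrability says that the
  convolution exists.
\<close>

definition entire_solution ::
    "(real \<Rightarrow> real) \<Rightarrow> (real \<Rightarrow> real \<Rightarrow> real) \<Rightarrow> (real \<Rightarrow> real \<Rightarrow> real) \<Rightarrow> bool" where
  "entire_solution J f u \<longleftrightarrow>
     (\<forall>t x. u t x \<ge> 0 \<and>
        integrable lborel (\<lambda>y. J (x - y) * u t y) \<and>
        ((\<lambda>s. u s x) has_real_derivative (convol J (u t) x - u t x + f t (u t x))) (at t))"

text \<open>
  \<^const>\<open>diameter\<close> is meaningful for bounded sets only, hence the separate boundedness clause.
\<close>

definition transition_front ::
    "(real \<Rightarrow> real) \<Rightarrow> (real \<Rightarrow> real \<Rightarrow> real) \<Rightarrow> (real \<Rightarrow> real \<Rightarrow> real) \<Rightarrow> bool" where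
  "transition_front J f u \<longleftrightarrow>
     entire_solution J f u \<and>
     (\<forall>t. (u t \<longlongrightarrow> 1) at_bot \<and> (u t \<longlongrightarrow> 0) at_top) \<and>
     (\<forall>\<epsilon>. 0 < \<epsilon> \<and> \<epsilon> < 1 \<longrightarrow>
        (\<forall>t. bounded {x. \<epsilon> \<le> u t x \<and> u t x \<le> 1 - \<epsilon>}) \<and>
        bdd_above (range (\<lambda>t. diameter {x. \<epsilon> \<le> u t x \<and> u t x \<le> 1 - \<epsilon>})))"

definition front_properties :: "(real \<Rightarrow> real \<Rightarrow> real) \<Rightarrow> bool" where
  "front_properties u \<longleftrightarrow>
     (\<forall>t. strict_antimono_on UNIV (u t)) \<and>
     bdd_above {\<bar>(u t y - u t x) / (y - x)\<bar> | t x y. x \<noteq> y} \<and>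
     (\<exists>X cmin cmax cp cm hp hm.
        X C1_differentiable_on UNIV \<and>
        cmin > 0 \<and> cmax > 0 \<and> cp > 0 \<and> cm > 0 \<and> hp > 0 \<and> hm > 0 \<and>
        (\<forall>t. cmin \<le> deriv X t \<and> deriv X t \<le> cmax \<and>
             (\<forall>x\<ge>0. u t (x + X t + hp) \<le> exp (- cp * x)) \<and>
             (\<forall>x\<le>0. u t (x + X t - hm) \<ge> 1 - exp (cm * x))))"

definition level_point :: "(real \<Rightarrow> real \<Rightarrow> real) \<Rightarrow> real \<Rightarrow> real \<Rightarrow> real" where
  "level_point u \<theta> t = (THE x. u t x = \<theta>)"

lemma level_point_unique:
  assumes "transition_front J f u" and P: "front_properties u" and "0 < \<theta>" "\<theta> < 1"
  shows "\<exists>!x. u t x = \<theta>"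
proof -
  from P obtain K where K: "\<bar>(u t y - u t x) / (y - x)\<bar> \<le> K" if "x \<noteq> y" for x y
    unfolding front_properties_def bdd_above_def by blast
  have "K-lipschitz_on UNIV (u t)"
  proof (rule lipschitz_onI)
    show "0 \<le> K" using K[of 0 1] by linarith
    fix x y
    show "dist (u t x) (u t y) \<le> K * dist x y"
      using K[of y x] by (cases "x = y") (auto simp: dist_real_def abs_divide field_simps)
  qed
  then have cont: "continuous_on S (u t)" for S
    using lipschitz_on_continuous_on continuous_on_subset by blast
  have lim: "(u t \<longlongrightarrow> 1) at_bot" "(u t \<longlongrightarrow> 0) at_top"
    using assms(1) unfolding transition_front_def by auto
  obtain a where a: "\<And>x. x \<le> a \<Longrightarrow> u t x > \<theta>"
    using order_tendstoD(1)[OF lim(1) \<open>\<theta> < 1\<close>] unfolding eventually_at_bot_linorder by blast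
  obtain b where b: "\<And>x. x \<ge> b \<Longrightarrow> u t x < \<theta>"
    using order_tendstoD(2)[OF lim(2) \<open>0 < \<theta>\<close>] unfolding eventually_at_top_linorder by blast
  have "\<exists>x. min a b \<le> x \<and> x \<le> max a b \<and> u t x = \<theta>"
    using a[of "min a b"] b[of "max a b"] cont by (intro IVT2') auto
  moreover have "u t y < u t x" if "x < y" for x y
    using P that unfolding front_properties_def monotone_on_def by blast
  ultimately show ?thesis
    by (metis less_irrefl linorder_less_linear)
qed

end

theory Submission
  imports Defs
begin

text \<open>
  The exponential tail bounds in (P) trap the \<open>\<theta>\<close>-level point between \<open>X t - const\<close> and
  \<open>X t + const\<close>, with constants independent of \<open>t\<close>: far enough to the right of \<open>X t\<close> the
  front is below \<open>\<theta>\<close>, far enough to the left it is above. Since the speed of \<open>X\<close> is bounded,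
  the level point is therefore Lipschitz at large scales,
  \<open>\<bar>X\<^sub>\<theta> t - X\<^sub>\<theta> s\<bar> \<le> C + c \<bar>t - s\<bar>\<close>. Both parts of the theorem follow from this single
  inequality: the first with \<open>\<bar>t - s\<bar> \<le> \<delta>\<close>, the second with \<open>s = 0\<close> after division by \<open>t\<close>.
\<close>

text \<open>
  The constant comes from solving \<open>exp (- cp * x) = \<theta>\<close> and \<open>1 - exp (cm * x) = \<theta>\<close> for \<open>x\<close>.
  At these offsets the tail bounds compare \<open>u t\<close> with \<open>\<theta>\<close>, and monotonicity converts the
  comparison of values into one of positions.
\<close>

lemma level_near_interface:
  fixes v :: "real \<Rightarrow> real"
  assumes mono: "strict_antimono_on UNIV v"
    and "cp > 0" "cm > 0" "0 < \<theta>" "\<theta> < 1"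
    and right: "\<And>x. x \<ge> 0 \<Longrightarrow> v (x + X + hp) \<le> exp (- cp * x)"
    and left: "\<And>x. x \<le> 0 \<Longrightarrow> v (x + X - hm) \<ge> 1 - exp (cm * x)"
    and level: "v p = \<theta>"
  shows "\<bar>p - X\<bar> \<le> \<bar>hp - ln \<theta> / cp\<bar> + \<bar>hm - ln (1 - \<theta>) / cm\<bar>"
proof -
  have decr: "v y < v x" if "x < y" for x y
    using mono that unfolding monotone_on_def by blast
  have "v (- ln \<theta> / cp + X + hp) \<le> exp (- cp * (- ln \<theta> / cp))"
    using assms by (intro right) (simp add: divide_nonpos_pos)
  also have "\<dots> = v p"
    using assms by simp
  finally have "p \<le> - ln \<theta> / cp + X + hp"
    using decr by (meson leD leI)
  moreover have "v p = 1 - exp (cm * (ln (1 - \<theta>) / cm))"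
    using assms by simp
  then have "v p \<le> v (ln (1 - \<theta>) / cm + X - hm)"
    using left[of "ln (1 - \<theta>) / cm"] assms by (simp add: divide_nonpos_pos)
  then have "p \<ge> ln (1 - \<theta>) / cm + X - hm"
    using decr by (meson leD leI)
  ultimately show ?thesis
    by linarith
qed

lemma level_point_coarse_lipschitz:
  assumes tf: "transition_front J f u" and P: "front_properties u" and \<theta>: "0 < \<theta>" "\<theta> < 1"
  obtains C c where "C \<ge> 0" "c \<ge> 0"
    "\<And>t s. \<bar>level_point u \<theta> t - level_point u \<theta> s\<bar> \<le> C + c * \<bar>t - s\<bar>"
proof -
  from P obtain X cmin cmax cp cm hp hm where
    X: "X C1_differentiable_on UNIV" and
    pos: "cmin > 0" "cmax > 0" "cp > 0" "cm > 0" and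
    bounds: "\<forall>t. cmin \<le> deriv X t \<and> deriv X t \<le> cmax \<and>
             (\<forall>x\<ge>0. u t (x + X t + hp) \<le> exp (- cp * x)) \<and>
             (\<forall>x\<le>0. u t (x + X t - hm) \<ge> 1 - exp (cm * x))"
    unfolding front_properties_def by (elim conjE exE)
  have speed: "cmin \<le> deriv X t" "deriv X t \<le> cmax" for t
    using bounds by simp_all
  have right: "u t (x + X t + hp) \<le> exp (- cp * x)" if "x \<ge> 0" for t x
    using bounds that by simp
  have left: "u t (x + X t - hm) \<ge> 1 - exp (cm * x)" if "x \<le> 0" for t x
    using bounds that by simp
  define D where "D = \<bar>hp - ln \<theta> / cp\<bar> + \<bar>hm - ln (1 - \<theta>) / cm\<bar>"
  have near: "\<bar>level_point u \<theta> t - X t\<bar> \<le> D" for t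
    unfolding D_def
  proof (rule level_near_interface[OF _ \<open>cp > 0\<close> \<open>cm > 0\<close> \<theta> right left])
    show "strict_antimono_on UNIV (u t)"
      using P unfolding front_properties_def by blast
    show "u t (level_point u \<theta> t) = \<theta>"
      unfolding level_point_def by (rule theI'[OF level_point_unique[OF tf P \<theta>]])
  qed
  have deriv: "(X has_real_derivative deriv X t) (at t)" for t
    using X by (simp add: C1_differentiable_on_eq DERIV_deriv_iff_real_differentiable)
  have "\<bar>deriv X t\<bar> \<le> cmax" for t
    using speed[of t] \<open>cmin > 0\<close> by linarith
  then have lip: "\<bar>X t - X s\<bar> \<le> cmax * \<bar>t - s\<bar>" for t s
    using field_differentiable_bound[of UNIV X "deriv X" cmax t s] deriv by simp
  have "\<bar>level_point u \<theta> t - level_point u \<theta> s\<bar> \<le> 2 * D + cmax * \<bar>t - s\<bar>" for t s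
    using near[of t] near[of s] lip[of t s] by linarith
  with pos show ?thesis
    by (intro that[of "2 * D" cmax]) (auto simp: D_def)
qed

lemma Limsup_abs_quotient_finite:
  fixes g :: "real \<Rightarrow> real"
  assumes "\<And>t. \<bar>g t\<bar> \<le> A + c * \<bar>t\<bar>" and "A \<ge> 0"
    and far: "eventually (\<lambda>t. \<bar>t\<bar> \<ge> 1) F"
  shows "Limsup F (\<lambda>t. ereal \<bar>g t / t\<bar>) < \<infinity>"
proof -
  have "eventually (\<lambda>t. ereal \<bar>g t / t\<bar> \<le> ereal (A + c)) F"
    using far
  proof eventually_elim
    case (elim t)
    have "\<bar>g t\<bar> \<le> A + c * \<bar>t\<bar>" by (rule assms)
    also have "\<dots> \<le> (A + c) * \<bar>t\<bar>"
      using mult_left_mono[OF elim \<open>A \<ge> 0\<close>] by (simp add: distrib_right)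
    finally show ?case
      using elim by (simp add: abs_divide divide_le_eq)
  qed
  then have "Limsup F (\<lambda>t. ereal \<bar>g t / t\<bar>) \<le> ereal (A + c)"
    by (rule Limsup_bounded)
  then show ?thesis
    by (rule le_less_trans) simp
qed

theorem theorem1p2:
  fixes J :: "real \<Rightarrow> real" and f u :: "real \<Rightarrow> real \<Rightarrow> real" and \<theta> :: real
  assumes "dispersal_kernel J"
    and "ignition_nonlinearity f \<theta>"
    and "transition_front J f u"
    and "front_properties u"
  shows "(\<forall>\<delta>>0. bdd_above {\<bar>level_point u \<theta> t - level_point u \<theta> s\<bar> | t s. \<bar>t - s\<bar> \<le> \<delta>}) \<and>
         Limsup at_top (\<lambda>t. ereal \<bar>level_point u \<theta> t / t\<bar>) < \<infinity> \<and>
         Limsup at_bot (\<lambda>t. ereal \<bar>level_point u \<theta> t / t\<bar>) < \<infinity>"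
proof -
  have \<theta>: "0 < \<theta>" "\<theta> < 1"
    using assms(2) unfolding ignition_nonlinearity_def by auto
  obtain C c where "C \<ge> 0" "c \<ge> 0" and
    lip: "\<And>t s. \<bar>level_point u \<theta> t - level_point u \<theta> s\<bar> \<le> C + c * \<bar>t - s\<bar>"
    using level_point_coarse_lipschitz[OF assms(3,4) \<theta>] by metis
  have bdd: "bdd_above {\<bar>level_point u \<theta> t - level_point u \<theta> s\<bar> | t s. \<bar>t - s\<bar> \<le> \<delta>}" for \<delta>
  proof (rule bdd_aboveI, clarify)
    fix t s :: real
    assume "\<bar>t - s\<bar> \<le> \<delta>"
    then show "\<bar>level_point u \<theta> t - level_point u \<theta> s\<bar> \<le> C + c * \<delta>"
      using lip[of t s] mult_left_mono[OF _ \<open>c \<ge> 0\<close>, of "\<bar>t - s\<bar>" \<delta>] by linarith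
  qed
  have growth:
    "\<bar>level_point u \<theta> t\<bar> \<le> (\<bar>level_point u \<theta> 0\<bar> + C) + c * \<bar>t\<bar>" for t
    using lip[of t 0] by simp
  have lim: "Limsup F (\<lambda>t. ereal \<bar>level_point u \<theta> t / t\<bar>) < \<infinity>"
    if "eventually (\<lambda>t. \<bar>t\<bar> \<ge> 1) F" for F
    using \<open>C \<ge> 0\<close> by (intro Limsup_abs_quotient_finite[OF growth _ that]) simp
  have top: "eventually (\<lambda>t::real. \<bar>t\<bar> \<ge> 1) at_top"
    using eventually_ge_at_top[of 1] by eventually_elim simp
  have bot: "eventually (\<lambda>t::real. \<bar>t\<bar> \<ge> 1) at_bot"
    using eventually_le_at_bot[of "-1"] by eventually_elim simp
  show ?thesis
    by (intro conjI allI impI bdd lim[OF top] lim[OF bot])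
qed

end
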